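(* Let $\mu\in\left(\frac12,\frac52\right)$ and $0<\varepsilon<1$. Let $d_3\ge\frac{2\mu+\varepsilon}{2\mu-1}$, put $\alpha=(5-2\mu)d_3+\varepsilon$ and $\alpha_2=\alpha_4=\alpha$, and let $d_1>0$ satisfy $$40d_1>4\mu+5d_3-2\mu d_3+\varepsilon,\qquad 24d_1>5d_3-2\mu d_3+\varepsilon.$$ Define $$\beta_1=\frac{2\alpha_2^2\left(\alpha_4+(2\mu-5)d_3\right)}{(10d_1-\mu+2\alpha_2)\alpha_4}+24d_1-\alpha_2,\quad \beta_3=\frac{2(2d_3-\mu)\alpha_2+(\beta_1-24d_1)\alpha_4}{\alpha_2},$$ $$\alpha_1=16d_1-4\mu+\beta_1,\quad \alpha_3=\frac{d_3\beta_1}{3d_1},\quad \kappa_1=\frac{5-2\mu}{\alpha_4},\quad \kappa_2=\frac{\beta_1(\alpha_2+\beta_1-24d_1)}{24d_1\alpha_2^2}.$$ Then $\alpha_1,\alpha_3,\beta_1,\beta_3,\kappa_1,\kappa_2$ are all positive. *)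

theory Defs
  imports Complex_Main
begin

end

(* Since alpha + (2 mu - 5) d3 = epsilon, the fraction T in beta1 is a positive multiple of
   epsilon, and beta1, beta3, alpha1 are T plus a quantity that is nonnegative by the lower
   bounds on 24 d1, d3 and 40 d1 respectively. *)
theory Submission
  imports Defs
begin

theorem mainTheorem6:
  fixes \<mu> \<epsilon> d\<^sub>1 d\<^sub>3 \<alpha> \<alpha>\<^sub>1 \<alpha>\<^sub>2 \<alpha>\<^sub>3 \<alpha>\<^sub>4 \<beta>\<^sub>1 \<beta>\<^sub>3 \<kappa>\<^sub>1 \<kappa>\<^sub>2 :: real
  assumes "\<mu> \<in> {1/2<..<5/2}"
    and "0 < \<epsilon>" and "\<epsilon> < 1"
    and "d\<^sub>3 \<ge> (2 * \<mu> + \<epsilon>) / (2 * \<mu> - 1)"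
    and "\<alpha> = (5 - 2 * \<mu>) * d\<^sub>3 + \<epsilon>"
    and "\<alpha>\<^sub>2 = \<alpha>" and "\<alpha>\<^sub>4 = \<alpha>"
    and "d\<^sub>1 > 0"
    and "40 * d\<^sub>1 > 4 * \<mu> + 5 * d\<^sub>3 - 2 * \<mu> * d\<^sub>3 + \<epsilon>"
    and "24 * d\<^sub>1 > 5 * d\<^sub>3 - 2 * \<mu> * d\<^sub>3 + \<epsilon>"
    and "\<beta>\<^sub>1 = 2 * \<alpha>\<^sub>2 ^ 2 * (\<alpha>\<^sub>4 + (2 * \<mu> - 5) * d\<^sub>3) / ((10 * d\<^sub>1 - \<mu> + 2 * \<alpha>\<^sub>2) * \<alpha>\<^sub>4)
               + 24 * d\<^sub>1 - \<alpha>\<^sub>2"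
    and "\<beta>\<^sub>3 = (2 * (2 * d\<^sub>3 - \<mu>) * \<alpha>\<^sub>2 + (\<beta>\<^sub>1 - 24 * d\<^sub>1) * \<alpha>\<^sub>4) / \<alpha>\<^sub>2"
    and "\<alpha>\<^sub>1 = 16 * d\<^sub>1 - 4 * \<mu> + \<beta>\<^sub>1"
    and "\<alpha>\<^sub>3 = d\<^sub>3 * \<beta>\<^sub>1 / (3 * d\<^sub>1)"
    and "\<kappa>\<^sub>1 = (5 - 2 * \<mu>) / \<alpha>\<^sub>4"
    and "\<kappa>\<^sub>2 = \<beta>\<^sub>1 * (\<alpha>\<^sub>2 + \<beta>\<^sub>1 - 24 * d\<^sub>1) / (24 * d\<^sub>1 * \<alpha>\<^sub>2 ^ 2)"
  shows "\<alpha>\<^sub>1 > 0 \<and> \<alpha>\<^sub>3 > 0 \<and> \<beta>\<^sub>1 > 0 \<and> \<beta>\<^sub>3 > 0 \<and> \<kappa>\<^sub>1 > 0 \<and> \<kappa>\<^sub>2 > 0"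
proof -
  \<comment> \<open>The fraction in \<open>\<beta>\<^sub>1\<close> with its numerator factor reduced
    to \<epsilon> and one \<alpha> cancelled.\<close>
  define T where "T = 2 * \<alpha> * \<epsilon> / (10 * d\<^sub>1 - \<mu> + 2 * \<alpha>)"
  have \<mu>: "2 * \<mu> - 1 > 0" "5 - 2 * \<mu> > 0"
    using assms(1) by auto
  have d3_bound: "2 * \<mu> + \<epsilon> \<le> d\<^sub>3 * (2 * \<mu> - 1)"
    using assms(4) \<mu> by (simp add: pos_divide_le_eq)
  \<comment> \<open>As \<mu> > 1/2, the left side of \<open>d3_bound\<close> is positive, hence so
    is the product on its right, whose second factor is positive.\<close>
  have d3: "d\<^sub>3 > 0"
    using d3_bound \<mu> \<open>0 < \<epsilon>\<close> zero_less_mult_pos2[of d\<^sub>3 "2 * \<mu> - 1"] by linarith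
  have \<alpha>: "\<alpha> > 0"
    using assms(5) \<mu> d3 \<open>0 < \<epsilon>\<close> by (simp add: add_pos_pos)
  \<comment> \<open>In this form the two lower bounds on \<open>d\<^sub>1\<close> read
    \<open>40 * d\<^sub>1 > 4 * \<mu> + \<alpha>\<close> and
    \<open>24 * d\<^sub>1 > \<alpha>\<close>. They become linear once
    \<open>\<mu> * d\<^sub>3\<close> is treated as an atom.\<close>
  have \<alpha>_expand: "\<alpha> = 5 * d\<^sub>3 - 2 * \<mu> * d\<^sub>3 + \<epsilon>"
    using assms(5) by (simp add: algebra_simps)
  \<comment> \<open>A quarter of the first bound gives
    \<open>10 * d\<^sub>1 - \<mu> > \<alpha> / 4\<close>, so the sum exceeds
    \<open>9 * \<alpha> / 4\<close>.\<close>
  have D: "10 * d\<^sub>1 - \<mu> + 2 * \<alpha> > 0"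
    using assms(9) \<alpha> \<alpha>_expand by linarith
  have T: "T > 0"
    unfolding T_def using \<alpha> D \<open>0 < \<epsilon>\<close> by simp
  have "\<alpha> + (2 * \<mu> - 5) * d\<^sub>3 = \<epsilon>"
    using assms(5) by (simp add: algebra_simps)
  then have \<beta>1_eq: "\<beta>\<^sub>1 = T + 24 * d\<^sub>1 - \<alpha>"
    using assms(11) \<alpha> D unfolding \<open>\<alpha>\<^sub>2 = \<alpha>\<close> \<open>\<alpha>\<^sub>4 = \<alpha>\<close> T_def
    by (simp add: power2_eq_square)
  then have \<beta>1: "\<beta>\<^sub>1 > 0"
    using T assms(10) \<alpha>_expand by linarith
  have "\<beta>\<^sub>3 = 2 * (2 * d\<^sub>3 - \<mu>) + (\<beta>\<^sub>1 - 24 * d\<^sub>1)"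
    using assms(12) \<alpha> unfolding \<open>\<alpha>\<^sub>2 = \<alpha>\<close> \<open>\<alpha>\<^sub>4 = \<alpha>\<close>
    by (simp add: add_divide_distrib)
  \<comment> \<open>Here \<open>\<beta>\<^sub>1 - 24 * d\<^sub>1\<close> is
    \<open>T - \<alpha>\<close>. Collecting the terms in \<open>d\<^sub>3\<close> leaves T plus
    exactly the slack of \<open>d3_bound\<close>, which may be zero, so strictness comes from
    T.\<close>
  then have "\<beta>\<^sub>3 = d\<^sub>3 * (2 * \<mu> - 1) - (2 * \<mu> + \<epsilon>) + T"
    using \<beta>1_eq \<alpha>_expand by (simp add: algebra_simps)
  then have \<beta>3: "\<beta>\<^sub>3 > 0"
    using d3_bound T by linarith
  \<comment> \<open>The \<open>d\<^sub>1\<close> terms add up, 16 + 24 = 40, giving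
    \<open>\<alpha>\<^sub>1 = (40 * d\<^sub>1 - 4 * \<mu> - \<alpha>) + T\<close>.\<close>
  have \<alpha>1: "\<alpha>\<^sub>1 > 0"
    using assms(9) assms(13) \<beta>1_eq \<alpha>_expand T by linarith
  have \<alpha>3: "\<alpha>\<^sub>3 > 0"
    using assms(14) d3 \<beta>1 \<open>d\<^sub>1 > 0\<close> by simp
  have \<kappa>1: "\<kappa>\<^sub>1 > 0"
    using assms(15) \<mu> \<alpha> \<open>\<alpha>\<^sub>4 = \<alpha>\<close> by simp
  \<comment> \<open>The factor \<open>\<alpha>\<^sub>2 + \<beta>\<^sub>1 - 24 * d\<^sub>1\<close>
    undoes the shift in \<open>\<beta>1_eq\<close> and is T itself.\<close>
  have "\<kappa>\<^sub>2 = \<beta>\<^sub>1 * T / (24 * d\<^sub>1 * \<alpha> ^ 2)"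
    using assms(16) \<beta>1_eq \<open>\<alpha>\<^sub>2 = \<alpha>\<close> by simp
  then have "\<kappa>\<^sub>2 > 0"
    using \<beta>1 T \<alpha> \<open>d\<^sub>1 > 0\<close> by simp
  with \<alpha>1 \<alpha>3 \<beta>1 \<beta>3 \<kappa>1 show ?thesis
    by blast
qed

end
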